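(* For all $A,B,B',C\in\widehat{\mathbb F_q}$ and all $x,y\in\mathbb F_q$, $$\mathbb F_1(A;B,\varepsilon;C;x,y)=\varepsilon(y)\;{}_2\mathbb F_1\left[\begin{array}{rr}B,&A\\&C\end{array};x\right]-\varepsilon(x)\,\overline AC(1-y)\,B\overline C(y)\,\overline B(y-x)$$ and $$\mathbb F_1(A;\varepsilon,B';C;x,y)=\varepsilon(x)\;{}_2\mathbb F_1\left[\begin{array}{rr}B',&A\\&C\end{array};y\right]-\varepsilon(y)\,\overline AC(1-x)\,B'\overline C(x)\,\overline{B'}(x-y).$$
   Context: Let $p$ be a prime, $r\ge1$ an integer, $q=p^r$, and $\mathbb F_q$ the finite field with $q$ elements. $\widehat{\mathbb F_q}$ denotes the group of (complex-valued) multiplicative characters of $\mathbb F_q^*$; every character $\chi$, including the trivial character $\varepsilon$, is extended to $\mathbb F_q$ by $\chi(0)=0$. $\overline\chi$ is the inverse of $\chi$. Juxtaposition of characters denotes their product, and e.g. $AC(-1)$ means $(AC)(-1)$, $\overline AC$ means the product of $\overline A$ and $C$. For $A,B,C\in\widehat{\mathbb F_q}$ and $x\in\mathbb F_q$, $${}_2\mathbb F_1\left[\begin{array}{rr}A,&B\\&C\end{array};x\right]=\varepsilon(x)\,BC(-1)\sum_{u\in\mathbb F_q}B(u)\,\overline BC(1-u)\,\overline A(1-ux).$$ For $A,B,B',C\in\widehat{\mathbb F_q}$ and $x,y\in\mathbb F_q$, $$\mathbb F_1(A;B,B';C;x,y)=\varepsilon(xy)\,AC(-1)\sum_{u\in\mathbb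 F_q}A(u)\,\overline AC(1-u)\,\overline B(1-ux)\,\overline{B'}(1-uy).$$ *)

theory Defs
  imports Complex_Main "HOL-Library.Cardinality" "HOL-Algebra.Group" "HOL-Computational_Algebra.Primes"
begin

text \<open>A multiplicative character is a homomorphism from the nonzero elements of the field to the
  nonzero complex numbers. It is represented by its extension by 0 to the whole field (also for
  the trivial character), so that equality of functions is equality of characters.\<close>

definition mult_chars :: "('a::field \<Rightarrow> complex) set" where
  "mult_chars = {\<chi>. \<chi> 0 = 0 \<and> (\<forall>x. x \<noteq> 0 \<longrightarrow> \<chi> x \<noteq> 0) \<and>
     (\<forall>x y. x \<noteq> 0 \<longrightarrow> y \<noteq> 0 \<longrightarrow> \<chi> (x * y) = \<chi> x * \<chi> y)}"

definition triv_char :: "'a::field \<Rightarrow> complex" ("\<epsilon>") where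
  "\<epsilon> = (\<lambda>x. if x = 0 then 0 else 1)"

definition char_mult :: "('a::field \<Rightarrow> complex) \<Rightarrow> ('a \<Rightarrow> complex) \<Rightarrow> ('a \<Rightarrow> complex)"
    (infixl "\<odot>" 70) where
  "A \<odot> B = (\<lambda>x. A x * B x)"

text \<open>Since \<open>inverse 0 = 0\<close> in HOL, the pointwise inverse again vanishes at 0.\<close>

definition char_inv :: "('a::field \<Rightarrow> complex) \<Rightarrow> ('a \<Rightarrow> complex)" where
  "char_inv A = (\<lambda>x. inverse (A x))"

definition char_group :: "('a::field \<Rightarrow> complex) monoid" where
  "char_group = \<lparr>carrier = mult_chars, monoid.mult = (\<odot>), one = \<epsilon>\<rparr>"

lemma mult_chars_mult: "A \<in> mult_chars \<Longrightarrow> B \<in> mult_chars \<Longrightarrow> A \<odot> B \<in> mult_chars"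
  by (simp add: mult_chars_def char_mult_def)

lemma mult_chars_inv: "A \<in> mult_chars \<Longrightarrow> char_inv A \<in> mult_chars"
  by (simp add: mult_chars_def char_inv_def)

lemma triv_char_in_mult_chars: "\<epsilon> \<in> mult_chars"
  by (simp add: mult_chars_def triv_char_def)

lemma char_inv_left: "A \<in> mult_chars \<Longrightarrow> char_inv A \<odot> A = \<epsilon>"
  by (auto simp: mult_chars_def char_inv_def char_mult_def triv_char_def)

lemma char_mult_triv: "A \<in> mult_chars \<Longrightarrow> \<epsilon> \<odot> A = A"
  by (auto simp: mult_chars_def char_mult_def triv_char_def)

lemma char_mult_assoc: "A \<odot> B \<odot> C = A \<odot> (B \<odot> C)"
  by (simp add: char_mult_def mult.assoc)

lemma char_mult_commute: "A \<odot> B = B \<odot> A"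
  by (simp add: char_mult_def mult.commute)

lemma comm_group_char_group: "comm_group (char_group :: ('a::field \<Rightarrow> complex) monoid)"
proof (rule comm_groupI)
  fix A assume "A \<in> carrier (char_group :: ('a \<Rightarrow> complex) monoid)"
  then show "\<exists>B\<in>carrier char_group. B \<otimes>\<^bsub>char_group\<^esub> A = \<one>\<^bsub>char_group\<^esub>"
    by (auto simp: char_group_def intro!: bexI[of _ "char_inv A"] mult_chars_inv char_inv_left)
qed (auto simp: char_group_def mult_chars_mult triv_char_in_mult_chars char_mult_triv
       char_mult_assoc intro: char_mult_commute)

lemma inv_char_group:
  assumes "A \<in> mult_chars"
  shows "inv\<^bsub>char_group\<^esub> A = char_inv A"
proof -
  interpret comm_group char_group
    by (rule comm_group_char_group)
  show ?thesis
    using assms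
    by (intro inv_equality) (auto simp: char_group_def mult_chars_inv char_inv_left)
qed

definition hyp2F1 ::
    "('a::{field,finite} \<Rightarrow> complex) \<Rightarrow> ('a \<Rightarrow> complex) \<Rightarrow> ('a \<Rightarrow> complex) \<Rightarrow> 'a \<Rightarrow> complex" where
  "hyp2F1 A B C x = \<epsilon> x * (B \<odot> C) (-1) *
     (\<Sum>u\<in>UNIV. B u * (char_inv B \<odot> C) (1 - u) * char_inv A (1 - u * x))"

definition appellF1 ::
    "('a::{field,finite} \<Rightarrow> complex) \<Rightarrow> ('a \<Rightarrow> complex) \<Rightarrow> ('a \<Rightarrow> complex) \<Rightarrow> ('a \<Rightarrow> complex)
       \<Rightarrow> 'a \<Rightarrow> 'a \<Rightarrow> complex" where
  "appellF1 A B B' C x y = \<epsilon> (x * y) * (A \<odot> C) (-1) *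
     (\<Sum>u\<in>UNIV. A u * (char_inv A \<odot> C) (1 - u) * char_inv B (1 - u * x) * char_inv B' (1 - u * y))"

end

theory Submission
  imports Defs
begin

text \<open>
  When \<open>B' = \<epsilon>\<close>, the factor \<open>\<epsilon> (1 - u * y)\<close> in the sum
  defining the Appell function is 1 except at the single point \<open>u = 1/y\<close>, where it is 0. So the
  sum is the one that defines the hypergeometric function, with one term removed
  (lemma \<open>sum_triv_char_linear\<close>). By multiplicativity the removed term is
  \<open>AC(-1) A(1/y) (C/A)((y - 1)/y) (1/B)((y - x)/y)\<close>. Its powers of \<open>y\<close> collect to
  \<open>(B/C)(y)\<close>, and its signs to \<open>C(-1)\<^sup>2 = 1\<close> (lemma \<open>removed_term\<close>).
  If \<open>x = 0\<close> or \<open>y = 0\<close>, all terms vanish. The second identity follows from the first, because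
  the Appell function is invariant under exchanging \<open>(B, x)\<close> with \<open>(B', y)\<close>.
\<close>

lemma mult_char_mult:
  assumes "\<chi> \<in> mult_chars"
  shows "\<chi> (a * b) = \<chi> a * \<chi> b"
  using assms by (cases "a = 0 \<or> b = 0") (auto simp: mult_chars_def)

lemma mult_char_eq_0_iff:
  assumes "\<chi> \<in> mult_chars"
  shows "\<chi> a = 0 \<longleftrightarrow> a = 0"
  using assms by (auto simp: mult_chars_def)

lemma mult_char_1:
  assumes "\<chi> \<in> mult_chars"
  shows "\<chi> 1 = 1"
  using mult_char_mult[OF assms, of 1 1] mult_char_eq_0_iff[OF assms, of 1] by simp

lemma mult_char_inverse:
  assumes "\<chi> \<in> mult_chars"
  shows "\<chi> (inverse a) = inverse (\<chi> a)"
proof (cases "a = 0")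
  case True
  then show ?thesis using mult_char_eq_0_iff[OF assms, of 0] by simp
next
  case False
  then have "\<chi> (inverse a) * \<chi> a = 1"
    by (simp add: mult_char_1[OF assms] flip: mult_char_mult[OF assms])
  then show ?thesis
    using inverse_unique[of "\<chi> a" "\<chi> (inverse a)"] by (simp add: mult.commute)
qed

lemma mult_char_minus_1_squared:
  assumes "\<chi> \<in> mult_chars"
  shows "\<chi> (-1) * \<chi> (-1) = 1"
  using mult_char_mult[OF assms, of "-1" "-1"] mult_char_1[OF assms] by simp

lemma char_inv_triv_char: "char_inv \<epsilon> = \<epsilon>"
  by (auto simp: char_inv_def triv_char_def)

lemma sum_triv_char_linear:
  fixes y :: "'a::{field,finite}"
  assumes "y \<noteq> 0"
  shows "(\<Sum>u\<in>UNIV. f u * \<epsilon> (1 - u * y)) = (\<Sum>u\<in>UNIV. f u) - f (inverse y)"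
proof -
  have "1 - u * y = 0 \<longleftrightarrow> u = inverse y" for u
    using assms by (auto simp: field_simps)
  then have "(\<Sum>u\<in>UNIV. f u * \<epsilon> (1 - u * y)) = (\<Sum>u\<in>UNIV. f u - (if u = inverse y then f u else 0))"
    by (intro sum.cong) (auto simp: triv_char_def)
  then show ?thesis
    by (simp add: sum_subtractf)
qed

text \<open>
  This is the boundary term of the reduction formula: it appears because \<open>\<epsilon>\<close> vanishes at 0.
  Each argument containing \<open>inverse y\<close> is a multiple of it, so that everything
  reduces to multiplicativity. At \<open>y = 1\<close> or \<open>x = y\<close> both sides are 0.
\<close>

lemma removed_term:
  fixes x y :: "'a::field"
  assumes A: "A \<in> mult_chars" and B: "B \<in> mult_chars" and C: "C \<in> mult_chars" and y: "y \<noteq> 0"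
  shows "(A \<odot> C) (-1) *
      (A (inverse y) * (char_inv A \<odot> C) (1 - inverse y) * char_inv B (1 - inverse y * x)) =
    (char_inv A \<odot> C) (1 - y) * (B \<odot> char_inv C) y * char_inv B (y - x)"
proof -
  define D where "D = char_inv A \<odot> C"
  have D: "D \<in> mult_chars"
    unfolding D_def by (intro mult_chars_mult mult_chars_inv A C)
  have iB: "char_inv B \<in> mult_chars"
    by (intro mult_chars_inv B)
  have "1 - inverse y = (-1) * ((1 - y) * inverse y)"
    using y by (simp add: field_simps)
  then have 1: "D (1 - inverse y) = D (-1) * (D (1 - y) * inverse (D y))"
    by (simp only: mult_char_mult[OF D] mult_char_inverse[OF D])
  have "1 - inverse y * x = (y - x) * inverse y"
    using y by (simp add: field_simps)
  then have 2: "char_inv B (1 - inverse y * x) = char_inv B (y - x) * inverse (char_inv B y)"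
    by (simp only: mult_char_mult[OF iB] mult_char_inverse[OF iB])
  have 3: "(A \<odot> C) (-1) * D (-1) = 1"
    using mult_char_minus_1_squared[OF C] mult_char_eq_0_iff[OF A, of "-1"]
    by (simp add: D_def char_mult_def char_inv_def field_simps)
  have 4: "A (inverse y) * inverse (D y) * inverse (char_inv B y) = (B \<odot> char_inv C) y"
    using mult_char_eq_0_iff[OF A, of y] y
    by (simp add: D_def char_mult_def char_inv_def mult_char_inverse[OF A])
  have "(A \<odot> C) (-1) * (A (inverse y) * D (1 - inverse y) * char_inv B (1 - inverse y * x)) =
      ((A \<odot> C) (-1) * D (-1)) * D (1 - y) *
      (A (inverse y) * inverse (D y) * inverse (char_inv B y)) * char_inv B (y - x)"
    unfolding 1 2 by (simp only: mult_ac)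
  then show ?thesis
    unfolding 3 4 by (simp add: D_def)
qed

lemma appellF1_triv_char_right:
  fixes x y :: "'a::{field,finite}"
  assumes A: "A \<in> mult_chars" and B: "B \<in> mult_chars" and C: "C \<in> mult_chars"
  shows "appellF1 A B \<epsilon> C x y =
    \<epsilon> y * hyp2F1 B A C x
    - \<epsilon> x * (char_inv A \<odot> C) (1 - y) * (B \<odot> char_inv C) y * char_inv B (y - x)"
proof (cases "x = 0 \<or> y = 0")
  case True
  then show ?thesis
    using mult_char_eq_0_iff[OF B, of 0]
    by (auto simp: appellF1_def hyp2F1_def triv_char_def char_mult_def)
next
  case False
  then have y: "y \<noteq> 0" and \<epsilon>: "\<epsilon> x = 1" "\<epsilon> y = 1" "\<epsilon> (x * y) = 1"
    by (auto simp: triv_char_def)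
  show ?thesis
    unfolding appellF1_def hyp2F1_def char_inv_triv_char sum_triv_char_linear[OF y] \<epsilon>
      right_diff_distrib mult_1_left
    by (simp only: removed_term[OF A B C y])
qed

lemma appellF1_swap: "appellF1 A B B' C x y = appellF1 A B' B C y x"
  by (simp add: appellF1_def mult_ac)

theorem theorem3p1:
  fixes p r :: nat
    and A B B' C :: "'a::{field,finite} \<Rightarrow> complex"
    and x y :: 'a
  assumes "prime p" and "r \<ge> 1" and "CARD('a) = p ^ r"
    and "A \<in> mult_chars" and "B \<in> mult_chars" and "B' \<in> mult_chars" and "C \<in> mult_chars"
  shows "(appellF1 A B \<epsilon> C x y =
           \<epsilon> y * hyp2F1 B A C x
           - \<epsilon> x * (char_inv A \<odot> C) (1 - y) * (B \<odot> char_inv C) y * char_inv B (y - x)) \<and>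
         (appellF1 A \<epsilon> B' C x y =
           \<epsilon> x * hyp2F1 B' A C y
           - \<epsilon> y * (char_inv A \<odot> C) (1 - x) * (B' \<odot> char_inv C) x * char_inv B' (x - y))"
  using appellF1_triv_char_right[OF assms(4,5,7)]
    appellF1_triv_char_right[OF assms(4,6,7)] appellF1_swap[of A \<epsilon> B' C x y]
  by simp

end
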